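(* Let $T=(F_i)_{1\le i\le 4}$ be a very generic tetrahedron of flags in $\mathbb{CP}^2$ with edge coordinates $z_{ij}$ and face coordinates $z_{ijk}$, and let $T^*$ be its dual configuration. Then in the pre-Bloch group $\mathcal{P}(\mathbb{C})$, $$\beta(T)=\beta(T^* )+[-z_{123}]+[-z_{243}]+[-z_{134}]+[-z_{142}].$$
   Context: Let $V=\mathbb{C}^3$ with its standard basis. A flag of $\mathbb{P}(V)=\mathbb{CP}^2$ is a pair $([x],[f])\in\mathbb{P}(V)\times\mathbb{P}(V^* )$ with $f(x)=0$. The group $\mathrm{PGL}(3,\mathbb{C})$ acts on flags by $A([x],[f])=([Ax],[f\circ A^{-1}])$. Configurations of $m$ ordered flags are the $\mathrm{PGL}(3,\mathbb{C})$-orbits of $m$-tuples of flags. A configuration $([x_i],[f_i])_{1\le i\le m}$ is generic if $f_i(x_j)\neq 0$ for all $i\neq j$ and no three of the points $[x_i]$ are collinear. It is very generic if in addition no three of the lines $\ker f_i$ pass through a common point. A (very) generic tetrahedron of flags is a (very) generic configuration $T=([x_i],[f_i])_{1\le i\le 4}$ of four ordered flags. The dual of $F=([x],[f])$ is $F^*=([f],[x])$, viewed as a flag of $\mathbb{P}(V)$ by identifying $V^*$ with $V$ through the dual of the standard basis (and $V^{**}=V$). The dual configuration of $T=(F_i)$ is $T^*=(F_i^* )$; it is very generic when $T$ is. Cross-ratio: $X(a,b,c,d)=\frac{(a-c)(b-d)}{(a-d)(b-c)}$ for four distinct points of a projective line. Edge coordinates of a generic tetrahedron of flags $T$: for $i\ne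 j$, let $k,l$ be such that $(1,2,3,4)\mapsto(i,j,k,l)$ is an even permutation. Then $z_{ij}(T)=X(\ker f_i,\,x_ix_j,\,x_ix_k,\,x_ix_l)=\frac{f_i(x_k)\det(x_i,x_j,x_l)}{f_i(x_l)\det(x_i,x_j,x_k)}\in\mathbb{C}\setminus\{0,1\}$, the cross-ratio in the pencil of lines through $[x_i]$. Face coordinates: $z_{ijk}(T)=\frac{f_i(x_j)f_j(x_k)f_k(x_i)}{f_i(x_k)f_j(x_i)f_k(x_j)}$ for distinct $i,j,k$. (For very generic $T$ these are different from $0$ and $-1$.) The pre-Bloch group $\mathcal{P}(\mathbb{C})$ is the quotient of the free abelian group $\mathbb{Z}[\mathbb{C}\setminus\{0,1\}]$ by the subgroup generated by the elements $[x]-[y]+[\frac{y}{x}]-[\frac{1-x^{-1}}{1-y^{-1}}]+[\frac{1-x}{1-y}]$ for $x\neq y$ in $\mathbb{C}\setminus\{0,1\}$. For a generic tetrahedron of flags $T$, $\beta(T)=[z_{12}(T)]+[z_{21}(T)]+[z_{34}(T)]+[z_{43}(T)]\in\mathcal{P}(\mathbb{C})$. *)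

theory Defs
  imports "HOL-Analysis.Analysis" "HOL-Algebra.Free_Abelian_Groups"
begin

section \<open>Vectors and covectors of \<open>\<complex>\<^sup>3\<close>\<close>

text \<open>Elements of \<open>V = \<complex>\<^sup>3\<close> and of \<open>V\<^sup>*\<close> are both coordinate vectors, those of \<open>V\<^sup>*\<close> with
  respect to the dual of the standard basis.\<close>

definition pairing :: "complex^3 \<Rightarrow> complex^3 \<Rightarrow> complex" where
  "pairing f x = (\<Sum>i\<in>UNIV. f $ i * x $ i)"

definition det3 :: "complex^3 \<Rightarrow> complex^3 \<Rightarrow> complex^3 \<Rightarrow> complex" where
  "det3 x y z = det (vector [x, y, z] :: complex^3^3)"

lemma pairing_3: "pairing f x = f $ 1 * x $ 1 + f $ 2 * x $ 2 + f $ 3 * x $ 3"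
  by (simp add: pairing_def sum_3)

lemma det3_expand: "det3 x y z =
    x$1 * y$2 * z$3 + x$2 * y$3 * z$1 + x$3 * y$1 * z$2
  - x$1 * y$3 * z$2 - x$2 * y$1 * z$3 - x$3 * y$2 * z$1"
  by (simp add: det3_def det_3)

lemma pairing_scale: "pairing (a *s f) (b *s x) = a * b * pairing f x"
  by (simp add: pairing_3 algebra_simps)

lemma det3_scale: "det3 (a *s x) (b *s y) (c *s z) = a * b * c * det3 x y z"
  by (simp add: det3_expand algebra_simps)

lemma pairing_matrix: "pairing (f v* B) x = pairing f (B *v x)"
  by (simp add: pairing_3 vector_matrix_mult_def matrix_vector_mult_def sum_3 algebra_simps)

lemma matrix_inv_mult:
  fixes A :: "complex^3^3"
  assumes "invertible A"
  shows "A ** matrix_inv A = mat 1" "matrix_inv A ** A = mat 1"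
proof -
  have "A ** matrix_inv A = mat 1 \<and> matrix_inv A ** A = mat 1"
    unfolding matrix_inv_def using assms unfolding invertible_def by (rule someI_ex)
  then show "A ** matrix_inv A = mat 1" "matrix_inv A ** A = mat 1"
    by auto
qed

lemma matrix_inv_eqI:
  fixes A :: "complex^3^3"
  assumes "A ** B = mat 1" "B ** A = mat 1"
  shows "matrix_inv A = B"
proof -
  have "invertible A"
    using assms by (auto simp: invertible_def)
  then have "matrix_inv A ** A ** B = B"
    by (simp add: matrix_inv_mult)
  then show ?thesis
    by (simp add: matrix_mul_assoc[symmetric] assms)
qed

lemma matrix_inv_cancel:
  fixes A :: "complex^3^3"
  assumes "invertible A"
  shows "matrix_inv A *v (A *v x) = x" "A *v (matrix_inv A *v x) = x"
    "(f v* matrix_inv A) v* A = f" "(f v* A) v* matrix_inv A = f"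
  using matrix_inv_mult[OF assms]
  by (simp_all add: matrix_vector_mul_assoc vector_matrix_mul_assoc)

lemma act_eq_0_iff:
  fixes A :: "complex^3^3"
  assumes "invertible A"
  shows "A *v x = 0 \<longleftrightarrow> x = 0" "f v* matrix_inv A = 0 \<longleftrightarrow> f = 0"
  using matrix_inv_cancel(1)[OF assms, of x] matrix_inv_cancel(3)[OF assms, of f]
  by (metis matrix_vector_mult_0_right, metis vector_matrix_mult_0)

lemma act_scale: "A *v (a *s x) = a *s (A *v x)" "(a *s f) v* B = a *s (f v* B)"
  for A B :: "complex^3^3"
  by (simp_all add: vec_eq_iff matrix_vector_mult_def vector_matrix_mult_def
        sum_distrib_left mult_ac)

lemma pairing_act:
  "invertible A \<Longrightarrow> pairing (f v* matrix_inv A) (A *v x) = pairing f x"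
  by (simp add: pairing_matrix matrix_inv_cancel)

lemma pairing_commute: "pairing f x = pairing x f"
  by (simp add: pairing_3 mult.commute)

lemma det3_act: "det3 (A *v x) (A *v y) (A *v z) = det A * det3 x y z"
  by (simp add: det3_expand det_3 matrix_vector_mult_def sum_3 algebra_simps)

section \<open>Flags\<close>

text \<open>Rescaling \<open>x\<close> and \<open>f\<close> independently identifies the pairs with the same \<open>([x], [f])\<close>.\<close>

definition flag_rel :: "(complex^3) \<times> (complex^3) \<Rightarrow> (complex^3) \<times> (complex^3) \<Rightarrow> bool" where
  "flag_rel = (\<lambda>(x, f) (y, g). x \<noteq> 0 \<and> f \<noteq> 0 \<and> pairing f x = 0 \<and>
     (\<exists>a b. a \<noteq> 0 \<and> b \<noteq> 0 \<and> y = a *s x \<and> g = b *s f))"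

lemma flag_relE:
  assumes "flag_rel (x, f) (y, g)"
  obtains a b where "x \<noteq> 0" "f \<noteq> 0" "pairing f x = 0" "a \<noteq> 0" "b \<noteq> 0" "y = a *s x" "g = b *s f"
  using assms by (auto simp: flag_rel_def)

lemma flag_relI:
  "\<lbrakk>x \<noteq> 0; f \<noteq> 0; pairing f x = 0; a \<noteq> 0; b \<noteq> 0; y = a *s x; g = b *s f\<rbrakk> \<Longrightarrow>
   flag_rel (x, f) (y, g)"
  by (auto simp: flag_rel_def)

lemma flag_rel_refl: "flag_rel (x, f) (x, f) \<longleftrightarrow> x \<noteq> 0 \<and> f \<noteq> 0 \<and> pairing f x = 0"
  by (auto elim: flag_relE intro!: flag_relI[of _ _ 1 1])

lemma flag_rel_sym:
  assumes "flag_rel (x, f) (y, g)"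
  shows "flag_rel (y, g) (x, f)"
  using assms
proof (rule flag_relE)
  fix a b :: complex
  assume *: "x \<noteq> 0" "f \<noteq> 0" "pairing f x = 0" "a \<noteq> 0" "b \<noteq> 0" "y = a *s x" "g = b *s f"
  show ?thesis
    by (rule flag_relI[of _ _ "inverse a" "inverse b"])
       (use * in \<open>auto simp: pairing_scale vector_smult_assoc\<close>)
qed

lemma flag_rel_trans:
  assumes "flag_rel (x, f) (y, g)" "flag_rel (y, g) (z, h)"
  shows "flag_rel (x, f) (z, h)"
  using assms(1)
proof (rule flag_relE)
  fix a b :: complex
  assume *: "x \<noteq> 0" "f \<noteq> 0" "pairing f x = 0" "a \<noteq> 0" "b \<noteq> 0" "y = a *s x" "g = b *s f"
  from assms(2) show ?thesis
  proof (rule flag_relE)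
    fix c d :: complex
    assume **: "c \<noteq> 0" "d \<noteq> 0" "z = c *s y" "h = d *s g"
    show ?thesis
      by (rule flag_relI[of _ _ "c * a" "d * b"])
         (use * ** in \<open>auto simp: vector_smult_assoc\<close>)
  qed
qed

lemma part_equivp_flag_rel: "part_equivp flag_rel"
proof (rule part_equivpI)
  have "flag_rel (axis 1 1, axis 2 1) (axis 1 1, axis 2 1)"
    by (auto simp: flag_rel_refl pairing_3 axis_def vec_eq_iff)
  then show "\<exists>p. flag_rel p p" ..
  show "symp flag_rel"
    by (intro sympI) (metis flag_rel_sym surj_pair)
  show "transp flag_rel"
    by (intro transpI) (metis flag_rel_trans surj_pair)
qed

quotient_type flag = "(complex^3) \<times> (complex^3)" / partial: flag_rel
  by (rule part_equivp_flag_rel)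

lift_definition dual_flag :: "flag \<Rightarrow> flag" is "\<lambda>(x, f). (f, x)"
  by (auto simp: flag_rel_def pairing_3 mult.commute)

text \<open>\<open>A([x], [f]) = ([Ax], [f \<circ> A\<^sup>-\<^sup>1])\<close>; the value for singular \<open>A\<close> is irrelevant.\<close>

lift_definition flag_act :: "complex^3^3 \<Rightarrow> flag \<Rightarrow> flag" is
  "\<lambda>A (x, f). if invertible A then (A *v x, f v* matrix_inv A) else (x, f)"
proof -
  fix A :: "complex^3^3" and p q assume pq: "flag_rel p q"
  obtain x f y g where [simp]: "p = (x, f)" "q = (y, g)" by (cases p, cases q)
  from pq obtain a b where ab: "x \<noteq> 0" "f \<noteq> 0" "pairing f x = 0" "a \<noteq> 0" "b \<noteq> 0"
      "y = a *s x" "g = b *s f"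
    by (auto elim: flag_relE)
  have "A *v x \<noteq> 0 \<and> f v* matrix_inv A \<noteq> 0" if "invertible A"
    using ab(1,2) by (simp add: act_eq_0_iff that)
  then have "flag_rel (A *v x, f v* matrix_inv A) (A *v y, g v* matrix_inv A)" if "invertible A"
    using ab that
    by (intro flag_relI[of _ _ a b])
       (auto simp: pairing_act act_scale)
  then show "flag_rel (case p of (x, f) \<Rightarrow> if invertible A then (A *v x, f v* matrix_inv A) else (x, f))
      (case q of (x, f) \<Rightarrow> if invertible A then (A *v x, f v* matrix_inv A) else (x, f))"
    using pq by auto
qed

lemma flag_act_one: "flag_act (mat 1) F = F"
proof -
  have inv1: "invertible (mat 1 :: complex^3^3)" "matrix_inv (mat 1 :: complex^3^3) = mat 1"
    by (auto simp: invertible_def intro: matrix_inv_eqI exI[of _ "mat 1"])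
  show ?thesis
    by transfer (auto simp: inv1)
qed

lemma flag_act_mult:
  assumes "invertible A" "invertible B"
  shows "flag_act A (flag_act B F) = flag_act (A ** B) F"
proof -
  have inv: "matrix_inv (A ** B) = matrix_inv B ** matrix_inv A"
  proof (rule matrix_inv_eqI)
    have "A ** B ** (matrix_inv B ** matrix_inv A) = A ** (B ** matrix_inv B) ** matrix_inv A"
      by (simp add: matrix_mul_assoc)
    then show "A ** B ** (matrix_inv B ** matrix_inv A) = mat 1"
      by (simp add: matrix_inv_mult assms)
    have "matrix_inv B ** matrix_inv A ** (A ** B) = matrix_inv B ** (matrix_inv A ** A) ** B"
      by (simp add: matrix_mul_assoc)
    then show "matrix_inv B ** matrix_inv A ** (A ** B) = mat 1"
      by (simp add: matrix_inv_mult assms)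
  qed
  have "invertible (A ** B)"
    using assms by (rule invertible_mult)
  with assms inv show ?thesis
    by transfer
      (auto simp: matrix_vector_mul_assoc[symmetric] vector_matrix_mul_assoc[symmetric]
        flag_rel_refl act_eq_0_iff pairing_act)
qed

lemma dual_act_invertible:
  fixes A :: "complex^3^3"
  assumes "invertible A"
  shows "invertible (transpose (matrix_inv A))"
proof -
  have "transpose (matrix_inv A) ** transpose A = mat 1"
      "transpose A ** transpose (matrix_inv A) = mat 1"
    by (simp_all add: matrix_transpose_mul[symmetric] matrix_inv_mult assms)
  then show ?thesis
    unfolding invertible_def by blast
qed

lemma dual_flag_act:
  assumes "invertible A"
  shows "dual_flag (flag_act A F) = flag_act (transpose (matrix_inv A)) (dual_flag F)"
proof -
  have 1: "transpose (matrix_inv A) ** transpose A = mat 1"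
      "transpose A ** transpose (matrix_inv A) = mat 1"
    by (simp_all add: matrix_transpose_mul[symmetric] matrix_inv_mult assms)
  then have inv: "matrix_inv (transpose (matrix_inv A)) = transpose A"
    by (rule matrix_inv_eqI)
  with assms dual_act_invertible[OF assms] show ?thesis
    by transfer
      (auto simp: flag_rel_refl act_eq_0_iff pairing_act pairing_commute[of "_ *v _"])
qed

text \<open>\<open>f\<^sub>1(x\<^sub>2) = 0\<close>, where \<open>F\<^sub>i = ([x\<^sub>i], [f\<^sub>i])\<close>.\<close>

lift_definition incident :: "flag \<Rightarrow> flag \<Rightarrow> bool" is
  "\<lambda>(x1, f1) (x2, f2). pairing f1 x2 = 0"
  by (auto simp: flag_rel_def pairing_scale)

lift_definition collinear_points :: "flag \<Rightarrow> flag \<Rightarrow> flag \<Rightarrow> bool" is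
  "\<lambda>(x1, f1) (x2, f2) (x3, f3).
     \<exists>g. g \<noteq> 0 \<and> pairing g x1 = 0 \<and> pairing g x2 = 0 \<and> pairing g x3 = 0"
  by (auto simp: flag_rel_def pairing_scale[of 1 _ _, simplified])

lift_definition concurrent_lines :: "flag \<Rightarrow> flag \<Rightarrow> flag \<Rightarrow> bool" is
  "\<lambda>(x1, f1) (x2, f2) (x3, f3).
     \<exists>y. y \<noteq> 0 \<and> pairing f1 y = 0 \<and> pairing f2 y = 0 \<and> pairing f3 y = 0"
  by (auto simp: flag_rel_def pairing_scale[of _ _ 1, simplified])

text \<open>The cross-ratio of the lines \<open>ker f\<^sub>1\<close>, \<open>x\<^sub>1x\<^sub>2\<close>, \<open>x\<^sub>1x\<^sub>3\<close>, \<open>x\<^sub>1x\<^sub>4\<close>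
  through \<open>[x\<^sub>1]\<close>; see \<open>pencil_ratio_eq_cross_ratio\<close> below.\<close>

definition pencil_ratio_vec ::
  "(complex^3) \<times> (complex^3) \<Rightarrow> complex^3 \<Rightarrow> complex^3 \<Rightarrow> complex^3 \<Rightarrow> complex" where
  "pencil_ratio_vec = (\<lambda>(x1, f1) x2 x3 x4.
     (pairing f1 x3 * det3 x1 x2 x4) / (pairing f1 x4 * det3 x1 x2 x3))"

lemma pencil_ratio_vec_scale:
  assumes "a1 \<noteq> 0" "b1 \<noteq> 0" "a2 \<noteq> 0" "a3 \<noteq> 0" "a4 \<noteq> 0"
  shows "pencil_ratio_vec (a1 *s x1, b1 *s f1) (a2 *s x2) (a3 *s x3) (a4 *s x4) =
    pencil_ratio_vec (x1, f1) x2 x3 x4"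
proof -
  define c where "c = b1 * a1 * a2 * a3 * a4"
  have "c \<noteq> 0"
    using assms by (simp add: c_def)
  have "pencil_ratio_vec (a1 *s x1, b1 *s f1) (a2 *s x2) (a3 *s x3) (a4 *s x4) =
      (c * (pairing f1 x3 * det3 x1 x2 x4)) / (c * (pairing f1 x4 * det3 x1 x2 x3))"
    by (simp add: pencil_ratio_vec_def c_def pairing_scale det3_scale mult_ac)
  also have "\<dots> = pencil_ratio_vec (x1, f1) x2 x3 x4"
    unfolding pencil_ratio_vec_def using \<open>c \<noteq> 0\<close> by (simp add: mult_divide_mult_cancel_left)
  finally show ?thesis .
qed

lift_definition pencil_ratio :: "flag \<Rightarrow> flag \<Rightarrow> flag \<Rightarrow> flag \<Rightarrow> complex" is
  "\<lambda>F1 (x2, f2) (x3, f3) (x4, f4). pencil_ratio_vec F1 x2 x3 x4"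
  by (auto simp: flag_rel_def pencil_ratio_vec_scale)

definition cross_ratio :: "complex \<Rightarrow> complex \<Rightarrow> complex \<Rightarrow> complex \<Rightarrow> complex" where
  "cross_ratio a b c d = ((a - c) * (b - d)) / ((a - d) * (b - c))"

definition line_through :: "complex^3 \<Rightarrow> complex^3 \<Rightarrow> complex^3" where
  "line_through x y = vector [x$2 * y$3 - x$3 * y$2, x$3 * y$1 - x$1 * y$3, x$1 * y$2 - x$2 * y$1]"

text \<open>Here \<open>t \<mapsto> [g + t h]\<close> is an affine coordinate on the pencil of lines through
  \<open>[x\<^sub>1]\<close>; lines are given by the linear forms vanishing on them.\<close>

lemma pencil_ratio_eq_cross_ratio:
  assumes "f1 = k1 *s (g + a *s h)"
    and "line_through x1 x2 = k2 *s (g + b *s h)"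
    and "line_through x1 x3 = k3 *s (g + c *s h)"
    and "line_through x1 x4 = k4 *s (g + d *s h)"
    and "k1 \<noteq> 0" "k2 \<noteq> 0" "k3 \<noteq> 0" "k4 \<noteq> 0"
    and "det3 x1 x2 x3 \<noteq> 0" "det3 x1 x2 x4 \<noteq> 0"
  shows "pencil_ratio_vec (x1, f1) x2 x3 x4 = cross_ratio a b c d"
proof -
  have det: "det3 x y z = pairing (line_through x y) z" for x y z
    by (simp add: det3_expand pairing_3 line_through_def algebra_simps)
  have zero: "pairing (line_through x y) y = 0" for x y
    by (simp add: pairing_3 line_through_def algebra_simps)
  have lin: "pairing (k *s (g + t *s h)) y = k * (pairing g y + t * pairing h y)" for k t y
    by (simp add: pairing_3 algebra_simps)
  have g3: "pairing g x3 = - c * pairing h x3"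
    using zero[of x1 x3] \<open>k3 \<noteq> 0\<close> unfolding assms(3) lin by (simp add: add_eq_0_iff2)
  have g4: "pairing g x4 = - d * pairing h x4"
    using zero[of x1 x4] \<open>k4 \<noteq> 0\<close> unfolding assms(4) lin by (simp add: add_eq_0_iff2)
  have 1: "pairing f1 x3 = k1 * pairing h x3 * (a - c)" "pairing f1 x4 = k1 * pairing h x4 * (a - d)"
    unfolding assms(1) lin g3 g4 by (simp_all add: algebra_simps)
  have 2: "det3 x1 x2 x3 = k2 * pairing h x3 * (b - c)" "det3 x1 x2 x4 = k2 * pairing h x4 * (b - d)"
    unfolding det assms(2) lin g3 g4 by (simp_all add: algebra_simps)
  have h3: "pairing h x3 \<noteq> 0" and h4: "pairing h x4 \<noteq> 0"
    using 2 assms(9,10) by auto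
  have eq: "k1 * u * p * (k2 * v * q) / (k1 * v * r * (k2 * u * s)) = p * q / (r * s)"
    if "u \<noteq> 0" "v \<noteq> 0" for u v p q r s :: complex
    using that assms(5,6) by (simp add: field_simps)
  show ?thesis
    unfolding pencil_ratio_vec_def cross_ratio_def by (simp only: prod.case 1 2 eq[OF h3 h4])
qed

lift_definition triple_ratio :: "flag \<Rightarrow> flag \<Rightarrow> flag \<Rightarrow> complex" is
  "\<lambda>(x1, f1) (x2, f2) (x3, f3).
     (pairing f1 x2 * pairing f2 x3 * pairing f3 x1) / (pairing f1 x3 * pairing f2 x1 * pairing f3 x2)"
  by (auto simp: flag_rel_def pairing_scale) (simp add: mult.assoc)

lemma flag_act_invariants:
  assumes "invertible A"
  shows "incident (flag_act A F1) (flag_act A F2) = incident F1 F2"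
    and "collinear_points (flag_act A F1) (flag_act A F2) (flag_act A F3) = collinear_points F1 F2 F3"
    and "concurrent_lines (flag_act A F1) (flag_act A F2) (flag_act A F3) = concurrent_lines F1 F2 F3"
    and "pencil_ratio (flag_act A F1) (flag_act A F2) (flag_act A F3) (flag_act A F4) =
      pencil_ratio F1 F2 F3 F4"
    and "triple_ratio (flag_act A F1) (flag_act A F2) (flag_act A F3) = triple_ratio F1 F2 F3"
proof -
  have dA: "det A \<noteq> 0"
    using assms invertible_det_nz by blast
  note [simp] = assms pairing_act
  show "incident (flag_act A F1) (flag_act A F2) = incident F1 F2"
    using assms by transfer auto
  show "triple_ratio (flag_act A F1) (flag_act A F2) (flag_act A F3) = triple_ratio F1 F2 F3"
    using assms by transfer auto
  show "pencil_ratio (flag_act A F1) (flag_act A F2) (flag_act A F3) (flag_act A F4) =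
      pencil_ratio F1 F2 F3 F4"
    using assms dA by transfer (auto simp: pencil_ratio_vec_def det3_act)
  have "(\<exists>g. g \<noteq> 0 \<and> pairing g (A *v x) = 0 \<and> pairing g (A *v y) = 0 \<and> pairing g (A *v z) = 0) \<longleftrightarrow>
      (\<exists>g. g \<noteq> 0 \<and> pairing g x = 0 \<and> pairing g y = 0 \<and> pairing g z = 0)"
    (is "(\<exists>g. ?P g) \<longleftrightarrow> (\<exists>g. ?Q g)") for x y z
  proof
    assume "\<exists>g. ?P g"
    then obtain g where g: "?P g" by blast
    then have "g v* A \<noteq> 0"
      using matrix_inv_cancel(4)[OF assms, of g] by (metis vector_matrix_mult_0)
    with g have "?Q (g v* A)" by (simp add: pairing_matrix)
    then show "\<exists>g. ?Q g" by blast
  next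
    assume "\<exists>g. ?Q g"
    then obtain g where g: "?Q g" by blast
    then have "g v* matrix_inv A \<noteq> 0"
      using matrix_inv_cancel(3)[OF assms, of g] by (metis vector_matrix_mult_0)
    with g have "?P (g v* matrix_inv A)" by simp
    then show "\<exists>g. ?P g" by blast
  qed
  then show "collinear_points (flag_act A F1) (flag_act A F2) (flag_act A F3) = collinear_points F1 F2 F3"
    using assms by transfer (auto split: prod.splits)
  have "(\<exists>y. y \<noteq> 0 \<and> pairing (f v* matrix_inv A) y = 0 \<and> pairing (g v* matrix_inv A) y = 0 \<and>
        pairing (h v* matrix_inv A) y = 0) \<longleftrightarrow>
      (\<exists>y. y \<noteq> 0 \<and> pairing f y = 0 \<and> pairing g y = 0 \<and> pairing h y = 0)"
    (is "(\<exists>y. ?P y) \<longleftrightarrow> (\<exists>y. ?Q y)") for f g h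
  proof
    assume "\<exists>y. ?P y"
    then obtain y where y: "?P y" by blast
    then have "matrix_inv A *v y \<noteq> 0"
      using matrix_inv_cancel(2)[OF assms, of y] by (metis matrix_vector_mult_0_right)
    with y have "?Q (matrix_inv A *v y)" by (simp add: pairing_matrix)
    then show "\<exists>y. ?Q y" by blast
  next
    assume "\<exists>y. ?Q y"
    then obtain y where y: "?Q y" by blast
    then have "A *v y \<noteq> 0"
      using matrix_inv_cancel(1)[OF assms, of y] by (metis matrix_vector_mult_0_right)
    with y have "?P (A *v y)" by simp
    then show "\<exists>y. ?P y" by blast
  qed
  then show "concurrent_lines (flag_act A F1) (flag_act A F2) (flag_act A F3) = concurrent_lines F1 F2 F3"
    using assms by transfer (auto split: prod.splits)
qed

section \<open>Configurations of flags\<close>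

text \<open>Tuples are indexed by a type \<open>'m\<close>; \<open>GL(3, \<complex>)\<close> and \<open>PGL(3, \<complex>)\<close> have the
  same orbits.\<close>

definition config_rel :: "('m \<Rightarrow> flag) \<Rightarrow> ('m \<Rightarrow> flag) \<Rightarrow> bool" where
  "config_rel F G \<longleftrightarrow> (\<exists>A. invertible A \<and> (\<forall>i. G i = flag_act A (F i)))"

lemma config_relE:
  assumes "config_rel F G"
  obtains A where "invertible A" "G = (\<lambda>i. flag_act A (F i))"
  using assms by (auto simp: config_rel_def)

lemma equivp_config_rel: "equivp config_rel"
proof (rule equivpI)
  show "reflp config_rel"
    by (rule reflpI) (auto simp: config_rel_def flag_act_one invertible_def
        intro!: exI[of _ "mat 1"])
  show "symp config_rel"
  proof (rule sympI)
    fix F G :: "'m \<Rightarrow> flag" assume "config_rel F G"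
    then obtain A where A: "invertible A" "G = (\<lambda>i. flag_act A (F i))"
      by (rule config_relE)
    have "invertible (matrix_inv A)"
      using matrix_inv_mult[OF A(1)] by (auto simp: invertible_def)
    then show "config_rel G F"
      unfolding config_rel_def using A
      by (auto simp: flag_act_mult flag_act_one matrix_inv_mult intro!: exI[of _ "matrix_inv A"])
  qed
  show "transp config_rel"
  proof (rule transpI)
    fix F G H :: "'m \<Rightarrow> flag" assume "config_rel F G" "config_rel G H"
    then obtain A B where "invertible A" "G = (\<lambda>i. flag_act A (F i))"
      "invertible B" "H = (\<lambda>i. flag_act B (G i))"
      by (elim config_relE)
    then show "config_rel F H"
      unfolding config_rel_def by (auto simp: flag_act_mult invertible_mult intro!: exI[of _ "B ** A"])
  qed
qed

quotient_type 'm config = "'m \<Rightarrow> flag" / config_rel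
  by (rule equivp_config_rel)

lift_definition dual_config :: "'m config \<Rightarrow> 'm config" is "\<lambda>F i. dual_flag (F i)"
proof -
  fix F G :: "'m \<Rightarrow> flag" assume "config_rel F G"
  then obtain A where A: "invertible A" "G = (\<lambda>i. flag_act A (F i))"
    by (rule config_relE)
  have "invertible (transpose (matrix_inv A))"
    using A(1) by (rule dual_act_invertible)
  then show "config_rel (\<lambda>i. dual_flag (F i)) (\<lambda>i. dual_flag (G i))"
    unfolding config_rel_def using A by (auto simp: dual_flag_act)
qed

lift_definition generic :: "'m config \<Rightarrow> bool" is
  "\<lambda>F. (\<forall>i j. i \<noteq> j \<longrightarrow> \<not> incident (F i) (F j)) \<and>
       (\<forall>i j k. distinct [i, j, k] \<longrightarrow> \<not> collinear_points (F i) (F j) (F k))"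
  by (elim config_relE) (simp add: flag_act_invariants)

lift_definition no_three_lines_concurrent :: "'m config \<Rightarrow> bool" is
  "\<lambda>F. \<forall>i j k. distinct [i, j, k] \<longrightarrow> \<not> concurrent_lines (F i) (F j) (F k)"
  by (elim config_relE) (simp add: flag_act_invariants)

definition very_generic :: "'m config \<Rightarrow> bool" where
  "very_generic T \<longleftrightarrow> generic T \<and> no_three_lines_concurrent T"

lemma very_generic_dual_config:
  assumes "very_generic T"
  shows "very_generic (dual_config T)"
proof -
  have 1: "incident (dual_flag F1) (dual_flag F2) = incident F2 F1" for F1 F2
    by transfer (auto simp: pairing_commute)
  have 2: "collinear_points (dual_flag F1) (dual_flag F2) (dual_flag F3) =
      concurrent_lines F1 F2 F3" for F1 F2 F3
    by transfer (simp add: pairing_commute split: prod.splits)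
  have 3: "concurrent_lines (dual_flag F1) (dual_flag F2) (dual_flag F3) =
      collinear_points F1 F2 F3" for F1 F2 F3
    by transfer (simp add: pairing_commute split: prod.splits)
  show ?thesis
    using assms unfolding very_generic_def by transfer (simp add: 1 2 3)
qed

section \<open>Coordinates of tetrahedra of flags\<close>

text \<open>Tetrahedra are configurations indexed by the four-element type \<open>4\<close>, whose elements are
  \<open>1, 2, 3, 4\<close> (with \<open>4 = 0\<close>). For \<open>i \<noteq> j\<close> this is the unique pair \<open>(k, l)\<close>
  such that \<open>(1, 2, 3, 4) \<mapsto> (i, j, k, l)\<close> is an even permutation.\<close>

definition even_completion :: "4 \<Rightarrow> 4 \<Rightarrow> 4 \<times> 4" where
  "even_completion i j =
     (THE (k, l). \<exists>p. p permutes UNIV \<and> evenperm p \<and> p 1 = i \<and> p 2 = j \<and> p 3 = k \<and> p 4 = l)"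

lemma even_completion_eqI:
  assumes p: "p permutes UNIV" "evenperm p"
  shows "even_completion (p 1) (p 2) = (p 3, p 4)"
proof -
  have "(k, l) = (p 3, p 4)"
    if q: "q permutes UNIV" "evenperm q" "q 1 = p 1" "q 2 = p 2" "q 3 = k" "q 4 = l" for q k l
  proof (rule ccontr)
    assume ne: "(k, l) \<noteq> (p 3, p 4)"
    have inj: "inj p" "inj q" and surj: "surj p"
      using p(1) q(1) by (auto simp: permutes_inj permutes_surj)
    have num: "(1::4) \<noteq> 2" "(1::4) \<noteq> 3" "(1::4) \<noteq> 4" "(2::4) \<noteq> 3" "(2::4) \<noteq> 4" "(3::4) \<noteq> 4"
      by simp_all
    have "q i \<in> {p 3, p 4}" if "i = 3 \<or> i = 4" for i
    proof -
      obtain j where j: "q i = p j"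
        using surj by (metis surjD)
      have "j \<noteq> 1" "j \<noteq> 2"
        using j q(3,4) inj(2) that num by (metis injD)+
      then show ?thesis
        using j exhaust_4[of j] by auto
    qed
    from this[of 3] this[of 4] have "q 3 \<in> {p 3, p 4}" "q 4 \<in> {p 3, p 4}"
      by simp_all
    moreover have "q 3 \<noteq> q 4"
      using inj(2) num by (metis injD)
    ultimately have "q 3 = p 4" "q 4 = p 3"
      using ne q(5,6) by auto
    then have "q = p \<circ> Transposition.transpose 3 4"
    proof (intro ext)
      fix i
      show "q i = (p \<circ> Transposition.transpose 3 4) i"
        using exhaust_4[of i] \<open>q 3 = p 4\<close> \<open>q 4 = p 3\<close> q(3,4) num
        by (auto simp: Transposition.transpose_def)
    qed
    moreover have "permutation p"
      using p(1) by (auto intro: permutes_imp_permutation[of UNIV])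
    ultimately show False
      using p(2) q(2) num
      by (simp add: evenperm_comp permutation_swap_id evenperm_swap)
  qed
  with p have char: "(case kl of (k, l) \<Rightarrow> \<exists>q. q permutes UNIV \<and> evenperm q \<and>
      q 1 = p 1 \<and> q 2 = p 2 \<and> q 3 = k \<and> q 4 = l) \<longleftrightarrow> kl = (p 3, p 4)" for kl
    by (cases kl) blast
  then show ?thesis
    unfolding even_completion_def by (intro the_equality) (simp_all only: char)
qed

lemma even_completion_values:
  "even_completion 1 2 = (3, 4)" "even_completion 2 1 = (4, 3)"
  "even_completion 3 4 = (1, 2)" "even_completion 4 3 = (2, 1)"
proof -
  have p: "Transposition.transpose a b \<circ> Transposition.transpose c d permutes UNIV"
      "evenperm (Transposition.transpose a b \<circ> Transposition.transpose c d)"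
    if "a \<noteq> b" "c \<noteq> d" for a b c d :: 4
    using that by (auto simp: evenperm_comp permutation_swap_id evenperm_swap
        intro!: permutes_compose permutes_swap_id)
  show "even_completion 1 2 = (3, 4)"
    using even_completion_eqI[OF permutes_id] by simp
  show "even_completion 2 1 = (4, 3)"
    using even_completion_eqI[OF p[of 1 2 3 4]] by (simp add: Transposition.transpose_def)
  show "even_completion 3 4 = (1, 2)"
    using even_completion_eqI[OF p[of 1 3 2 4]] by (simp add: Transposition.transpose_def)
  show "even_completion 4 3 = (2, 1)"
    using even_completion_eqI[OF p[of 1 4 2 3]] by (simp add: Transposition.transpose_def)
qed

lift_definition edge_coord :: "4 config \<Rightarrow> 4 \<Rightarrow> 4 \<Rightarrow> complex" is
  "\<lambda>F i j. case even_completion i j of (k, l) \<Rightarrow> pencil_ratio (F i) (F j) (F k) (F l)"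
  by (elim config_relE) (simp add: flag_act_invariants split: prod.splits)

lift_definition face_coord :: "4 config \<Rightarrow> 4 \<Rightarrow> 4 \<Rightarrow> 4 \<Rightarrow> complex" is
  "\<lambda>F i j k. triple_ratio (F i) (F j) (F k)"
  by (elim config_relE) (simp add: flag_act_invariants)

section \<open>The pre-Bloch group\<close>

definition five_term :: "complex \<Rightarrow> complex \<Rightarrow> complex \<Rightarrow>\<^sub>0 int" where
  "five_term x y = frag_of x - frag_of y + frag_of (y / x)
     - frag_of ((1 - inverse x) / (1 - inverse y)) + frag_of ((1 - x) / (1 - y))"

definition five_term_subgroup :: "(complex \<Rightarrow>\<^sub>0 int) set" where
  "five_term_subgroup = generate (free_Abelian_group (- {0, 1}))
     {five_term x y | x y. x \<in> - {0, 1} \<and> y \<in> - {0, 1} \<and> x \<noteq> y}"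

text \<open>As always in \<open>HOL-Algebra\<close>, the group operation is written \<open>\<otimes>\<close> although the group is
  written additively on paper.\<close>

definition pre_Bloch :: "(complex \<Rightarrow>\<^sub>0 int) set monoid" where
  "pre_Bloch = free_Abelian_group (- {0, 1}) Mod five_term_subgroup"

definition Bloch_class :: "complex \<Rightarrow> (complex \<Rightarrow>\<^sub>0 int) set" where
  "Bloch_class z = five_term_subgroup #>\<^bsub>free_Abelian_group (- {0, 1})\<^esub> frag_of z"

lemma five_term_subgroup_normal:
  "five_term_subgroup \<lhd> free_Abelian_group (- {0, 1})"
proof -
  interpret comm_group "free_Abelian_group (- {0, 1 :: complex})"
    by (rule abelian_free_Abelian_group)
  have "Poly_Mapping.keys (five_term x y) \<subseteq> - {0, 1}"
    if "x \<in> - {0, 1}" "y \<in> - {0, 1}" "x \<noteq> y" for x y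
  proof -
    have "{x, y, y / x, (1 - inverse x) / (1 - inverse y), (1 - x) / (1 - y)} \<subseteq> - {0, 1}"
      using that by (auto simp: field_simps)
    moreover have "Poly_Mapping.keys (five_term x y) \<subseteq>
        {x, y, y / x, (1 - inverse x) / (1 - inverse y), (1 - x) / (1 - y)}"
      unfolding five_term_def
      by (intro order.trans[OF keys_diff] order.trans[OF Poly_Mapping.keys_add] Un_least) auto
    ultimately show ?thesis by blast
  qed
  then have "subgroup five_term_subgroup (free_Abelian_group (- {0, 1}))"
    unfolding five_term_subgroup_def by (intro generate_is_subgroup) auto
  then show ?thesis
    by (rule subgroup_imp_normal)
qed

lemma comm_group_pre_Bloch: "comm_group pre_Bloch"
  unfolding pre_Bloch_def
  by (intro comm_group.abelian_FactGroup abelian_free_Abelian_group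
      normal_imp_subgroup five_term_subgroup_normal)

lemma Bloch_class_closed: "z \<in> - {0, 1} \<Longrightarrow> Bloch_class z \<in> carrier pre_Bloch"
  unfolding pre_Bloch_def Bloch_class_def FactGroup_def RCOSETS_def by auto

definition Bloch_invariant :: "4 config \<Rightarrow> (complex \<Rightarrow>\<^sub>0 int) set" where
  "Bloch_invariant T = Bloch_class (edge_coord T 1 2) \<otimes>\<^bsub>pre_Bloch\<^esub> Bloch_class (edge_coord T 2 1)
     \<otimes>\<^bsub>pre_Bloch\<^esub> Bloch_class (edge_coord T 3 4) \<otimes>\<^bsub>pre_Bloch\<^esub> Bloch_class (edge_coord T 4 3)"

end

theory Submission
  imports Defs
begin

text \<open>
  Every cross-ratio in the identity can be read off in one single pencil, that of the lines through
  \<open>x\<^sub>1\<close>. Write \<open>[a b c d]\<close> for the class of the cross-ratio of the lines from \<open>x\<^sub>1\<close> to the points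
  \<open>a, b, c, d\<close>, write \<open>\<ell>\<close> for a point of \<open>ker f\<^sub>1\<close> other than \<open>x\<^sub>1\<close>, \<open>q\<^sub>i\<^sub>j\<close> for \<open>ker f\<^sub>i \<inter> ker f\<^sub>j\<close>, and \<open>r\<close> for
  \<open>ker f\<^sub>2 \<inter> x\<^sub>3x\<^sub>4\<close>. A cross-ratio of four points of a line \<open>ker f\<^sub>j\<close> with \<open>j \<noteq> 1\<close> is projected from \<open>x\<^sub>1\<close>;
  the pencils through \<open>x\<^sub>3\<close> and \<open>x\<^sub>4\<close> are cut with \<open>ker f\<^sub>2\<close>, and the one through \<open>x\<^sub>2\<close> with \<open>x\<^sub>3x\<^sub>4\<close>,
  before projecting from \<open>x\<^sub>1\<close>; the line \<open>ker f\<^sub>1\<close> is first projected to \<open>ker f\<^sub>2\<close> from \<open>q\<^sub>3\<^sub>4\<close>. In this way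
  the twelve terms become symbols on the eight points \<open>\<ell>, x\<^sub>2, x\<^sub>3, x\<^sub>4, q\<^sub>2\<^sub>3, q\<^sub>2\<^sub>4, q\<^sub>3\<^sub>4, r\<close>
  (\<open>symbol_edges\<close>, \<open>symbol_dual_edges\<close>, \<open>symbol_faces\<close>).

  The identity is then the signed sum of the five-term relations of the six quintuples
  \<open>(\<ell>, x\<^sub>2, x\<^sub>3, x\<^sub>4, q\<^sub>2\<^sub>3)\<close>, \<open>(\<ell>, x\<^sub>3, x\<^sub>4, q\<^sub>2\<^sub>3, q\<^sub>3\<^sub>4)\<close>, \<open>(\<ell>, x\<^sub>4, q\<^sub>2\<^sub>3, q\<^sub>2\<^sub>4, q\<^sub>3\<^sub>4)\<close>,
  \<open>(\<ell>, x\<^sub>2, x\<^sub>4, q\<^sub>2\<^sub>3, q\<^sub>2\<^sub>4)\<close>, \<open>(x\<^sub>2, x\<^sub>3, x\<^sub>4, q\<^sub>2\<^sub>3, r)\<close>, \<open>(x\<^sub>2, x\<^sub>4, q\<^sub>2\<^sub>3, q\<^sub>2\<^sub>4, r)\<close>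
  with signs \<open>+, +, -, -, -, +\<close>. Of their thirty terms, twelve are those of the identity; the others
  cancel in pairs, seven pairs literally and two because a perspectivity carries one
  quadruple of points to the other (\<open>symbol_perspective\<close>).

  Two features of \<open>\<P>(\<complex>)\<close> make this work. First, \<open>[1/z] = - [z]\<close> and \<open>[1 - z] = - [z]\<close> hold
  exactly, because every complex number is a square and \<open>w\<^sup>2 - w + 1\<close> has a root, so that symbols are
  alternating in their four points. Secondly, a very generic tetrahedron may have
  \<open>x\<^sub>1, x\<^sub>4, q\<^sub>2\<^sub>3\<close> collinear, and all six quintuples are then degenerate. With
  \<open>[0] = [1] = [\<infinity>] = 0\<close> the five-term relation persists as long as one of the five lines differs
  from the other four (\<open>pencil_five_term\<close>), which is so for each of the quintuples.
\<close>

section \<open>The pre-Bloch group, written additively\<close>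

text \<open>The carrier of \<open>pre_Bloch\<close> as a type: identities in this group become identities in an
  instance of \<^class>\<open>ab_group_add\<close>.\<close>

typedef bloch_group = "carrier pre_Bloch"
proof -
  interpret comm_group pre_Bloch by (rule comm_group_pre_Bloch)
  show ?thesis by (intro exI[of _ "\<one>\<^bsub>pre_Bloch\<^esub>"]) simp
qed

setup_lifting type_definition_bloch_group

instantiation bloch_group :: ab_group_add
begin

lift_definition zero_bloch_group :: bloch_group is "\<one>\<^bsub>pre_Bloch\<^esub>"
  by (intro monoid.one_closed group.is_monoid comm_group.axioms comm_group_pre_Bloch)

lift_definition plus_bloch_group :: "bloch_group \<Rightarrow> bloch_group \<Rightarrow> bloch_group"
  is "\<lambda>a b. a \<otimes>\<^bsub>pre_Bloch\<^esub> b"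
  by (intro monoid.m_closed group.is_monoid comm_group.axioms comm_group_pre_Bloch)

lift_definition uminus_bloch_group :: "bloch_group \<Rightarrow> bloch_group"
  is "\<lambda>a. inv\<^bsub>pre_Bloch\<^esub> a"
  by (intro group.inv_closed comm_group.axioms comm_group_pre_Bloch)

definition minus_bloch_group :: "bloch_group \<Rightarrow> bloch_group \<Rightarrow> bloch_group" where
  "minus_bloch_group a b = a + - b"

instance
proof -
  interpret comm_group pre_Bloch by (rule comm_group_pre_Bloch)
  show "OFCLASS(bloch_group, ab_group_add_class)"
  proof
    fix a b c :: bloch_group
    show "a + b + c = a + (b + c)" by transfer (rule m_assoc)
    show "a + b = b + a" by transfer (rule m_comm)
    show "0 + a = a" by transfer simp
    show "- a + a = 0" by transfer simp
    show "a - b = a + - b" by (fact minus_bloch_group_def)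
  qed
qed

end

text \<open>Setting \<open>[0] = [1] = 0\<close>, together with \<open>z / 0 = 0\<close>, makes every cross-ratio of four points that are
  not distinct contribute \<open>0\<close>, including those that equal \<open>\<infinity>\<close> or have the form \<open>0 / 0\<close>.\<close>

lift_definition bloch :: "complex \<Rightarrow> bloch_group"
  is "\<lambda>z. if z \<in> {0, 1} then \<one>\<^bsub>pre_Bloch\<^esub> else Bloch_class z"
proof -
  interpret comm_group pre_Bloch by (rule comm_group_pre_Bloch)
  show "(if z \<in> {0, 1} then \<one>\<^bsub>pre_Bloch\<^esub> else Bloch_class z) \<in> carrier pre_Bloch" for z
    by (simp add: Bloch_class_closed)
qed

lemma bloch_0 [simp]: "bloch 0 = 0" and bloch_1 [simp]: "bloch 1 = 0"
  by (transfer, simp)+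

lemma Rep_bloch: "z \<notin> {0, 1} \<Longrightarrow> Rep_bloch_group (bloch z) = Bloch_class z"
  by transfer simp

lemma Bloch_class_five_term:
  assumes "x \<notin> {0, 1}" "y \<notin> {0, 1}" "x \<noteq> y"
  shows "Bloch_class x \<otimes>\<^bsub>pre_Bloch\<^esub> Bloch_class (y / x)
        \<otimes>\<^bsub>pre_Bloch\<^esub> Bloch_class ((1 - x) / (1 - y)) =
      Bloch_class y \<otimes>\<^bsub>pre_Bloch\<^esub> Bloch_class ((1 - inverse x) / (1 - inverse y))"
proof -
  let ?G = "free_Abelian_group (- {0, 1 :: complex})"
  interpret normal five_term_subgroup ?G by (rule five_term_subgroup_normal)
  define w where "w = (1 - x) / (1 - y)"
  define u where "u = (1 - inverse x) / (1 - inverse y)"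
  have nd: "y / x \<notin> {0, 1}" "w \<notin> {0, 1}" "u \<notin> {0, 1}"
    using assms by (auto simp: w_def u_def field_simps)
  have G: "frag_of z \<in> carrier ?G" if "z \<notin> {0, 1}" for z
    using that by simp
  have prod: "(five_term_subgroup #>\<^bsub>?G\<^esub> a) \<otimes>\<^bsub>pre_Bloch\<^esub> (five_term_subgroup #>\<^bsub>?G\<^esub> b) =
      five_term_subgroup #>\<^bsub>?G\<^esub> (a + b)" if "a \<in> carrier ?G" "b \<in> carrier ?G" for a b
    using rcos_sum[OF that] by (simp add: pre_Bloch_def FactGroup_def)
  have sum: "a + b \<in> carrier ?G" if "a \<in> carrier ?G" "b \<in> carrier ?G" for a b
    using m_closed[OF that] by simp
  let ?l = "frag_of x + frag_of (y / x) + frag_of w" and ?r = "frag_of y + frag_of u"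
  have "five_term x y \<in> five_term_subgroup"
    unfolding five_term_subgroup_def using assms by (intro generate.incl) auto
  moreover have "?l = five_term x y \<otimes>\<^bsub>?G\<^esub> ?r"
    by (simp add: five_term_def w_def u_def)
  moreover have r: "?r \<in> carrier ?G"
    using assms nd by (intro sum G)
  ultimately have "?l \<in> five_term_subgroup #>\<^bsub>?G\<^esub> ?r"
    by (metis rcosI subset)
  then have "five_term_subgroup #>\<^bsub>?G\<^esub> ?l = five_term_subgroup #>\<^bsub>?G\<^esub> ?r"
    using repr_independence[OF _ r is_subgroup] by simp
  moreover note c = G[OF assms(1)] G[OF assms(2)] G[OF nd(1)] G[OF nd(2)] G[OF nd(3)]
  ultimately show ?thesis
    unfolding w_def[symmetric] u_def[symmetric] Bloch_class_def by (simp only: prod sum c)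
qed

lemma bloch_five_term:
  assumes "x \<notin> {0, 1}" "y \<notin> {0, 1}" "x \<noteq> y"
  shows "bloch x - bloch y + bloch (y / x)
     - bloch (((1 - x) * y) / (x * (1 - y))) + bloch ((1 - x) / (1 - y)) = 0"
proof -
  have u: "(1 - inverse x) / (1 - inverse y) = ((1 - x) * y) / (x * (1 - y))"
    using assms by (auto simp: divide_simps) (auto simp: algebra_simps)
  have nd: "y / x \<notin> {0, 1}" "(1 - x) / (1 - y) \<notin> {0, 1}" "((1 - x) * y) / (x * (1 - y)) \<notin> {0, 1}"
    using assms by (auto simp: divide_simps) (auto simp: algebra_simps)
  have "bloch x + bloch (y / x) + bloch ((1 - x) / (1 - y)) =
      bloch y + bloch (((1 - x) * y) / (x * (1 - y)))"
    using Bloch_class_five_term[OF assms] assms nd unfolding u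
    by (intro Rep_bloch_group_inject[THEN iffD1]) (simp add: plus_bloch_group.rep_eq Rep_bloch)
  then show ?thesis
    by (simp add: algebra_simps)
qed

section \<open>The six cross-ratios of four points\<close>

text \<open>Exchanging \<open>x\<close> and \<open>y\<close> in the five-term relation inverts its last three arguments, so the sum of both
  relations only contains elements \<open>s(z) = [z] + [1/z]\<close>, with arguments \<open>b = y/x\<close>,
  \<open>a = (1 - x)/(1 - y)\<close> and \<open>a b\<close>.\<close>

lemma bloch_inverse_sum_mult:
  assumes "a \<notin> {0, 1}" "b \<notin> {0, 1}" "a * b \<noteq> 1"
  shows "bloch (a * b) + bloch (1 / (a * b)) =
    (bloch a + bloch (1 / a)) + (bloch b + bloch (1 / b))"
proof -
  \<comment> \<open>the solution of \<open>y / x = b\<close> and \<open>(1 - x) / (1 - y) = a\<close>\<close>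
  define x where "x = (1 - a) / (1 - a * b)"
  define y where "y = b * x"
  have nz: "1 - a * b \<noteq> 0" "a \<noteq> 0" "b \<noteq> 0" "1 - a \<noteq> 0" "1 - b \<noteq> 0"
    using assms by auto
  have x1: "1 - x = a * (1 - b) / (1 - a * b)" and y1: "1 - y = (1 - b) / (1 - a * b)"
    unfolding y_def x_def using nz by (simp_all add: field_simps)
  have x0: "x \<noteq> 0" "1 - x \<noteq> 0" and y0: "y \<noteq> 0" "1 - y \<noteq> 0"
    using nz by (simp_all only: x1 y1) (simp_all add: x_def y_def)
  have ne: "x \<notin> {0, 1}" "y \<notin> {0, 1}" "x \<noteq> y"
    using x0 y0 nz by (auto simp: y_def)
  have q: "y / x = b" "x / y = 1 / b"
    using x0 nz by (simp_all add: y_def)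
  have w: "(1 - x) / (1 - y) = a" "(1 - y) / (1 - x) = 1 / a"
    using nz by (simp_all add: x1 y1)
  have u: "((1 - x) * y) / (x * (1 - y)) = a * b" "((1 - y) * x) / (y * (1 - x)) = 1 / (a * b)"
    using q w by (metis mult.commute times_divide_times_eq, metis mult.commute times_divide_times_eq mult_1)
  have "(bloch x - bloch y + bloch b - bloch (a * b) + bloch a) +
      (bloch y - bloch x + bloch (1 / b) - bloch (1 / (a * b)) + bloch (1 / a)) = 0"
    using bloch_five_term[OF ne] bloch_five_term[OF ne(2,1) ne(3)[symmetric]] by (simp add: q w u)
  then show ?thesis
    by (simp add: algebra_simps)
qed

text \<open>Since \<open>s(a b) = s(a) + s(b)\<close> and \<open>s(1/b) = s(b)\<close>, factoring \<open>a\<close> as \<open>(a b) (1/b)\<close> gives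
  \<open>s(a) = s(a) + 2 s(b)\<close>. So \<open>2 s(b) = 0\<close>, and \<open>s(z) = 2 s(\<surd>z) = 0\<close>.\<close>

lemma bloch_inverse: "bloch (1 / z) = - bloch z"
proof (cases "z \<in> {0, 1}")
  case False
  define s where "s z = bloch z + bloch (1 / z)" for z
  have s_mult: "s (a * b) = s a + s b" if "a \<notin> {0, 1}" "b \<notin> {0, 1}" "a * b \<noteq> 1" for a b
    using bloch_inverse_sum_mult[OF that] by (simp add: s_def)
  have s_double: "s b + s b = 0" if b: "b \<notin> {0, 1}" for b
  proof -
    have "infinite (UNIV - {0, 1, 1 / b})"
      using infinite_UNIV_char_0 by (intro Diff_infinite_finite) auto
    then obtain a where a: "a \<notin> {0, 1, 1 / b}"
      by (metis DiffE finite.emptyI equals0I)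
    have "s a = s ((a * b) * (1 / b))"
      using b by simp
    also have "\<dots> = s (a * b) + s (1 / b)"
      using a b by (intro s_mult) (auto simp: field_simps)
    also have "\<dots> = s a + s b + s b"
      using a b s_mult[of a b] by (auto simp: s_def field_simps)
    finally show ?thesis by (simp add: algebra_simps)
  qed
  have "csqrt z \<notin> {0, 1}"
    using False by (auto simp: csqrt_eq_1)
  then have "s z = s (csqrt z) + s (csqrt z)"
    using s_mult[of "csqrt z" "csqrt z"] False by (simp flip: power2_eq_square)
  also have "\<dots> = 0"
    using s_double \<open>csqrt z \<notin> {0, 1}\<close> by blast
  finally show ?thesis by (simp add: s_def eq_neg_iff_add_eq_0 add.commute)
qed auto

text \<open>The relations for \<open>(x, y)\<close> and for \<open>(1 - y, 1 - x)\<close> have the same last three terms up to order.\<close>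

lemma bloch_reflect_sum_const:
  assumes "x \<notin> {0, 1}" "y \<notin> {0, 1}"
  shows "bloch x + bloch (1 - x) = bloch y + bloch (1 - y)"
proof (cases "x = y")
  case False
  have "bloch (1 - y) - bloch (1 - x) + bloch ((1 - x) / (1 - y))
     - bloch (((1 - x) * y) / (x * (1 - y))) + bloch (y / x) = 0"
    using bloch_five_term[of "1 - y" "1 - x"] assms False by (auto simp: mult.commute)
  then have "(bloch x - bloch y + bloch (y / x)
      - bloch (((1 - x) * y) / (x * (1 - y))) + bloch ((1 - x) / (1 - y)))
    - (bloch (1 - y) - bloch (1 - x) + bloch ((1 - x) / (1 - y))
      - bloch (((1 - x) * y) / (x * (1 - y))) + bloch (y / x)) = 0"
    using bloch_five_term[OF assms False] by simp
  then show ?thesis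
    by (simp add: algebra_simps)
qed simp

text \<open>The constant is evaluated at a primitive sixth root of unity, where \<open>1 - w = 1/w\<close>.\<close>

lemma bloch_reflect: "bloch (1 - z) = - bloch z"
proof (cases "z \<in> {0, 1}")
  case False
  define w where "w = Complex (1 / 2) (sqrt 3 / 2)"
  have "w * (1 - w) = 1"
    by (simp add: w_def complex_eq_iff)
  then have w: "w \<notin> {0, 1}" "1 - w = 1 / w"
    by (auto simp: eq_divide_eq mult.commute)
  have "bloch z + bloch (1 - z) = bloch w + bloch (1 / w)"
    using bloch_reflect_sum_const[OF False w(1)] w(2) by simp
  then show ?thesis
    by (simp add: bloch_inverse eq_neg_iff_add_eq_0 add.commute)
qed auto

section \<open>The five-term relation for points in arbitrary position\<close>

text \<open>The relation for the five points \<open>\<infinity>, t\<^sub>1, t\<^sub>2, t\<^sub>3, t\<^sub>4\<close>, which need not be distinct. When two of them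
  coincide, three terms vanish by convention and the other two agree up to the symmetries
  \<open>bloch_inverse\<close> and \<open>bloch_reflect\<close>.\<close>

lemma bloch_five_term_affine:
  "bloch (((t\<^sub>1 - t\<^sub>3) * (t\<^sub>2 - t\<^sub>4)) / ((t\<^sub>1 - t\<^sub>4) * (t\<^sub>2 - t\<^sub>3))) - bloch ((t\<^sub>2 - t\<^sub>4) / (t\<^sub>2 - t\<^sub>3))
     + bloch ((t\<^sub>1 - t\<^sub>4) / (t\<^sub>1 - t\<^sub>3)) - bloch ((t\<^sub>1 - t\<^sub>4) / (t\<^sub>1 - t\<^sub>2))
     + bloch ((t\<^sub>1 - t\<^sub>3) / (t\<^sub>1 - t\<^sub>2)) = 0"
proof -
  have inv: "bloch (a / b) = - bloch (b / a)" for a b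
    using bloch_inverse[of "b / a"] by simp
  have refl: "bloch (a / c) = - bloch (b / c)" if "a + b = c" for a b c
    using that bloch_reflect[of "b / c"] by (cases "c = 0") (auto simp: field_simps)
  consider "t\<^sub>1 = t\<^sub>2" | "t\<^sub>1 = t\<^sub>3" | "t\<^sub>1 = t\<^sub>4" | "t\<^sub>2 = t\<^sub>3" | "t\<^sub>2 = t\<^sub>4" | "t\<^sub>3 = t\<^sub>4"
    | "distinct [t\<^sub>1, t\<^sub>2, t\<^sub>3, t\<^sub>4]" by auto
  then show ?thesis
  proof cases
    case 2
    show ?thesis
      using refl[of "t\<^sub>2 - t\<^sub>4" "t\<^sub>4 - t\<^sub>3" "t\<^sub>2 - t\<^sub>3"] minus_divide_divide[of "t\<^sub>3 - t\<^sub>4" "t\<^sub>3 - t\<^sub>2"]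
      by (simp add: 2)
  next
    case 3
    show ?thesis
      using refl[of "t\<^sub>4 - t\<^sub>3" "t\<^sub>3 - t\<^sub>2" "t\<^sub>4 - t\<^sub>2"] inv[of "t\<^sub>2 - t\<^sub>4" "t\<^sub>2 - t\<^sub>3"]
        minus_divide_divide[of "t\<^sub>2 - t\<^sub>3" "t\<^sub>2 - t\<^sub>4"]
      by (simp add: 3)
  next
    case 4
    show ?thesis
      by (simp add: 4)
  next
    case 5
    show ?thesis
      using inv[of "t\<^sub>1 - t\<^sub>4" "t\<^sub>1 - t\<^sub>3"] by (simp add: 5)
  next
    case 7
    \<comment> \<open>the affine coordinates of \<open>t\<^sub>3\<close> and \<open>t\<^sub>4\<close> that put \<open>t\<^sub>1\<close> at \<open>0\<close> and \<open>t\<^sub>2\<close> at \<open>1\<close>\<close>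
    define x where "x = (t\<^sub>1 - t\<^sub>3) / (t\<^sub>1 - t\<^sub>2)"
    define y where "y = (t\<^sub>1 - t\<^sub>4) / (t\<^sub>1 - t\<^sub>2)"
    have t: "t\<^sub>1 - t\<^sub>2 \<noteq> 0" "t\<^sub>1 - t\<^sub>3 \<noteq> 0" "t\<^sub>1 - t\<^sub>4 \<noteq> 0" "t\<^sub>2 - t\<^sub>3 \<noteq> 0" "t\<^sub>2 - t\<^sub>4 \<noteq> 0" "t\<^sub>3 - t\<^sub>4 \<noteq> 0"
      using 7 by auto
    have xy: "x \<notin> {0, 1}" "y \<notin> {0, 1}" "x \<noteq> y"
      using 7 by (auto simp: x_def y_def)
    have x1: "1 - x = - ((t\<^sub>2 - t\<^sub>3) / (t\<^sub>1 - t\<^sub>2))" and y1: "1 - y = - ((t\<^sub>2 - t\<^sub>4) / (t\<^sub>1 - t\<^sub>2))"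
      using t(1) by (simp_all add: x_def y_def divide_simps)
    have q: "y / x = (t\<^sub>1 - t\<^sub>4) / (t\<^sub>1 - t\<^sub>3)"
      using t by (simp add: x_def y_def)
    have w: "(1 - x) / (1 - y) = (t\<^sub>2 - t\<^sub>3) / (t\<^sub>2 - t\<^sub>4)"
      unfolding x1 y1 minus_divide_divide using t(1) by simp
    have u: "((1 - x) * y) / (x * (1 - y)) = ((t\<^sub>1 - t\<^sub>4) * (t\<^sub>2 - t\<^sub>3)) / ((t\<^sub>1 - t\<^sub>3) * (t\<^sub>2 - t\<^sub>4))"
      using q w by (metis mult.commute times_divide_times_eq)
    show ?thesis
      using bloch_five_term[OF xy] inv[of "t\<^sub>2 - t\<^sub>4" "t\<^sub>2 - t\<^sub>3"]
        inv[of "(t\<^sub>1 - t\<^sub>3) * (t\<^sub>2 - t\<^sub>4)" "(t\<^sub>1 - t\<^sub>4) * (t\<^sub>2 - t\<^sub>3)"]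
      unfolding q w u by (simp add: x_def y_def algebra_simps)
  qed auto
qed

section \<open>Cross-ratios in a pencil of lines\<close>

text \<open>The class of the cross-ratio of the lines from \<open>p\<close> to \<open>a, b, c, d\<close>: for points of the plane,
  \<open>det3 p a b\<close> plays the role of the difference of the coordinates of two lines through \<open>p\<close>.\<close>

definition pencil_symbol :: "complex^3 \<Rightarrow> complex^3 \<Rightarrow> complex^3 \<Rightarrow> complex^3 \<Rightarrow> complex^3 \<Rightarrow> bloch_group"
  where "pencil_symbol p a b c d =
    bloch ((det3 p a c * det3 p b d) / (det3 p a d * det3 p b c))"

lemma det3_swap: "det3 p b a = - det3 p a b"
  by (simp add: det3_expand)

lemma det3_plucker:
  "det3 p a b * det3 p c d - det3 p a c * det3 p b d + det3 p a d * det3 p b c = 0"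
  by (simp add: det3_expand algebra_simps)

text \<open>The next two transpositions turn the cross-ratio \<open>X\<close> into \<open>1/X\<close> and, by the Pluecker relation, into
  \<open>1 - X\<close>; they generate the permutations of the last three points.\<close>

lemma pencil_symbol_swap_34: "pencil_symbol p a b d c = - pencil_symbol p a b c d"
  unfolding pencil_symbol_def using bloch_inverse by (metis divide_divide_eq_right mult_1 times_divide_eq_right)

lemma pencil_symbol_swap_23: "pencil_symbol p a c b d = - pencil_symbol p a b c d"
proof (cases "det3 p a d * det3 p b c = 0")
  case True
  then show ?thesis by (auto simp: pencil_symbol_def det3_swap[of p c b])
next
  case False
  have "(det3 p a b * det3 p c d) / (det3 p a d * det3 p c b) =
      1 - (det3 p a c * det3 p b d) / (det3 p a d * det3 p b c)"
    using False det3_plucker[of p a b c d] by (simp add: det3_swap[of p c b] field_simps)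
  then show ?thesis
    by (simp add: pencil_symbol_def bloch_reflect)
qed

lemma pencil_symbol_cycle:
  "pencil_symbol p a c d b = pencil_symbol p a b c d"
  "pencil_symbol p a d b c = pencil_symbol p a b c d"
  by (metis pencil_symbol_swap_23 pencil_symbol_swap_34 minus_minus)+

lemma pencil_symbol_swap_24: "pencil_symbol p a d c b = - pencil_symbol p a b c d"
  by (metis pencil_symbol_swap_23 pencil_symbol_swap_34 minus_minus)

text \<open>The hypothesis says that the line \<open>pa\<close> differs from the other four lines, which may coincide.
  So \<open>pa\<close> can be put at infinity, and the relation is the affine one. In particular none of the
  vectors is proportional to \<open>p\<close>: such a vector defines no line.\<close>

lemma pencil_five_term:
  assumes "det3 p a b \<noteq> 0" "det3 p a c \<noteq> 0" "det3 p a d \<noteq> 0" "det3 p a e \<noteq> 0"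
  shows "pencil_symbol p b c d e - pencil_symbol p a c d e + pencil_symbol p a b d e
    - pencil_symbol p a b c e + pencil_symbol p a b c d = 0"
proof -
  \<comment> \<open>an affine coordinate on the pencil with \<open>pa\<close> at infinity and \<open>pb\<close> at \<open>0\<close>\<close>
  define t where "t u = det3 p b u / det3 p a u" for u
  have t: "t u - t v = - (det3 p a b * det3 p u v) / (det3 p a u * det3 p a v)"
    if "det3 p a u \<noteq> 0" "det3 p a v \<noteq> 0" for u v
    using det3_plucker[of p a b u v] that by (simp add: t_def divide_simps) (simp add: algebra_simps)
  have 1: "pencil_symbol p a u v w = bloch ((t u - t w) / (t u - t v))"
    if "det3 p a u \<noteq> 0" "det3 p a v \<noteq> 0" "det3 p a w \<noteq> 0" for u v w
    using assms(1) that by (simp add: pencil_symbol_def t mult.commute)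
  have "pencil_symbol p b c d e = bloch (((t b - t d) * (t c - t e)) / ((t b - t e) * (t c - t d)))"
    using assms by (simp add: pencil_symbol_def t)
  then show ?thesis
    using bloch_five_term_affine[where t\<^sub>1 = "t b" and t\<^sub>2 = "t c" and t\<^sub>3 = "t d" and t\<^sub>4 = "t e"] assms by (simp add: 1)
qed

section \<open>Eight lines through a vertex of a very generic tetrahedron\<close>

text \<open>Here \<open>line_through\<close>, the cross product, is applied to covectors: \<open>line_through f g\<close> is the common
  point of \<open>ker f\<close> and \<open>ker g\<close>.\<close>

lemma pairing_meet: "pairing f (line_through g h) = det3 f g h"
  by (simp add: pairing_3 det3_expand line_through_def algebra_simps)

lemma det3_meet:
  "det3 x y (line_through f g) = pairing f x * pairing g y - pairing f y * pairing g x"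
  "det3 x (line_through f g) y = pairing f y * pairing g x - pairing f x * pairing g y"
  by (simp_all add: pairing_3 det3_expand line_through_def algebra_simps)

lemma det3_meet_meet:
  "det3 x (line_through f g) (line_through f h) = det3 f g h * pairing f x"
  "det3 x (line_through f g) (line_through g h) = det3 f g h * pairing g x"
  "det3 x (line_through f h) (line_through g h) = det3 f g h * pairing h x"
  by (simp_all add: pairing_3 det3_expand line_through_def algebra_simps)

lemma det3_scale_diff: "det3 x y (s *s u - t *s v) = s * det3 x y u - t * det3 x y v"
  and pairing_scale_diff: "pairing f (s *s u - t *s v) = s * pairing f u - t * pairing f v"
  by (simp_all add: pairing_3 det3_expand algebra_simps)

text \<open>A linear form applied to the linear relation between four vectors of \<open>\<complex>\<^sup>3\<close>.\<close>

lemma det3_linear_relation: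
  "det3 x y z * pairing f w =
    det3 w y z * pairing f x - det3 w x z * pairing f y + det3 w x y * pairing f z"
  by (simp add: pairing_3 det3_expand algebra_simps)

text \<open>The determinant of the matrix of pairings.\<close>

lemma det3_mult:
  "det3 x y z * det3 f g h =
    pairing f x * pairing g y * pairing h z + pairing f y * pairing g z * pairing h x
    + pairing f z * pairing g x * pairing h y - pairing f x * pairing g z * pairing h y
    - pairing f y * pairing g x * pairing h z - pairing f z * pairing g y * pairing h x"
  by (simp add: pairing_3 det3_expand algebra_simps)

text \<open>Homogeneous coordinates of a very generic tetrahedron.\<close>

locale very_generic_vectors =
  fixes x f :: "4 \<Rightarrow> complex^3"
  assumes flag: "pairing (f i) (x i) = 0"
    and off_line: "i \<noteq> j \<Longrightarrow> pairing (f i) (x j) \<noteq> 0"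
    and not_collinear: "distinct [i, j, k] \<Longrightarrow> det3 (x i) (x j) (x k) \<noteq> 0"
    and not_concurrent: "distinct [i, j, k] \<Longrightarrow> det3 (f i) (f j) (f k) \<noteq> 0"
begin

abbreviation val where "val i j \<equiv> pairing (f i) (x j)"
abbreviation point_det where "point_det i j k \<equiv> det3 (x i) (x j) (x k)"
abbreviation line_det where "line_det i j k \<equiv> det3 (f i) (f j) (f k)"

abbreviation meet where "meet i j \<equiv> line_through (f i) (f j)"

text \<open>The point where \<open>ker f\<^sub>2\<close> crosses the line \<open>x\<^sub>3x\<^sub>4\<close>.\<close>

definition crossing where "crossing = val 2 3 *s x 4 - val 2 4 *s x 3"

lemmas [simp] = flag off_line not_collinear not_concurrent

text \<open>The brackets \<open>det3 (x 1) a b\<close> that occur in the six relations are, up to sign, monomials in the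
  pairings and the determinants, which is why the cross-ratios below can be compared factor by
  factor. The only exception is the bracket of \<open>x 4\<close> and \<open>meet 2 3\<close>, which may vanish.
  The point \<open>meet 1 2\<close> represents the line \<open>ker f\<^sub>1\<close> of the pencil.\<close>

lemma bracket_flag_line: "det3 (x 1) (meet 1 2) y = pairing (f 1) y * val 2 1"
  by (simp add: det3_meet)

lemma bracket_crossing:
  "det3 (x 1) (x 2) crossing = - (point_det 2 3 4 * val 2 1)"
  "det3 (x 1) (x 3) crossing = val 2 3 * point_det 1 3 4"
  "det3 (x 1) (x 4) crossing = val 2 4 * point_det 1 3 4"
  "det3 (x 1) (meet 2 3) crossing = - (val 2 1 * val 2 3 * val 3 4)"
  "det3 (x 1) (meet 2 4) crossing = val 2 1 * val 2 4 * val 4 3"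
proof -
  have "det3 (x 1) (x 3) (x 3) = 0" "det3 (x 1) (x 4) (x 4) = 0"
    by (simp_all add: det3_expand)
  then show "det3 (x 1) (x 3) crossing = val 2 3 * point_det 1 3 4"
    "det3 (x 1) (x 4) crossing = val 2 4 * point_det 1 3 4"
    by (simp_all add: crossing_def det3_scale_diff det3_swap[of "x 1" "x 4" "x 3"])
  show "det3 (x 1) (x 2) crossing = - (point_det 2 3 4 * val 2 1)"
    using det3_linear_relation[of "x 2" "x 3" "x 4" "f 2" "x 1"]
    by (simp add: crossing_def det3_scale_diff algebra_simps)
qed (simp_all add: crossing_def det3_meet pairing_scale_diff)

lemma bracket_meet:
  "det3 (x 1) (x 2) (meet 2 3) = val 2 1 * val 3 2"
  "det3 (x 1) (x 2) (meet 2 4) = val 2 1 * val 4 2"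
  "det3 (x 1) (x 3) (meet 2 3) = - (val 2 3 * val 3 1)"
  "det3 (x 1) (x 3) (meet 3 4) = val 3 1 * val 4 3"
  "det3 (x 1) (x 4) (meet 2 4) = - (val 2 4 * val 4 1)"
  "det3 (x 1) (x 4) (meet 3 4) = - (val 3 4 * val 4 1)"
  "det3 (x 1) (meet 2 3) (meet 2 4) = line_det 2 3 4 * val 2 1"
  "det3 (x 1) (meet 2 3) (meet 3 4) = line_det 2 3 4 * val 3 1"
  "det3 (x 1) (meet 2 4) (meet 3 4) = line_det 2 3 4 * val 4 1"
  by (simp_all add: det3_meet(1)[of _ "x _"] det3_meet_meet)

lemmas bracket_reorder =
  det3_swap[of "x 1" crossing]
  det3_swap[of "x 1" "meet 2 3" "x k" for k] det3_swap[of "x 1" "meet 2 4" "x k" for k]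
  det3_swap[of "x 1" "meet 3 4" "x k" for k]
  det3_swap[of "x 1" "meet 2 4" "meet 2 3"] det3_swap[of "x 1" "meet 3 4" "meet 2 3"]
  det3_swap[of "x 1" "meet 3 4" "meet 2 4"]

lemma det_reorder:
  "det3 (u 2) (u 1) w = - det3 (u 1) (u 2) w"
  "det3 (u 3) (u 4) w = det3 w (u 3) (u 4)"
  "det3 (u 4) (u 3) w = - det3 w (u 3) (u 4)" for u :: "4 \<Rightarrow> complex^3"
  by (simp_all add: det3_expand)

lemmas bracket_simps = bracket_reorder bracket_flag_line bracket_crossing bracket_meet pairing_meet
  det_reorder[of x] det_reorder[of f] pairing_commute[of "x i" "f j" for i j]

abbreviation symbol where "symbol \<equiv> pencil_symbol (x 1)"

text \<open>The pencils through \<open>x 3\<close> and \<open>x 4\<close> are cut with \<open>ker f\<^sub>2\<close>, which the line \<open>x\<^sub>3x\<^sub>4\<close> meets in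
  \<open>crossing\<close> and \<open>ker f\<^sub>j\<close> in \<open>meet 2 j\<close>. The pencil through \<open>x 2\<close> is cut with \<open>x\<^sub>3x\<^sub>4\<close>, which
  \<open>ker f\<^sub>2\<close> meets in \<open>crossing\<close>. The points obtained are projected from \<open>x 1\<close>; double transpositions of
  the four points do not change a cross-ratio.\<close>

lemma symbol_edges:
  "symbol (meet 1 2) (x 2) (x 3) (x 4) = bloch (pencil_ratio_vec (x 1, f 1) (x 2) (x 3) (x 4))"
  "symbol (x 2) crossing (x 3) (x 4) = bloch (pencil_ratio_vec (x 2, f 2) (x 1) (x 4) (x 3))"
  "symbol (x 2) (x 3) crossing (meet 2 3) = bloch (pencil_ratio_vec (x 3, f 3) (x 4) (x 1) (x 2))"
  "symbol (x 2) (x 4) (meet 2 4) crossing = bloch (pencil_ratio_vec (x 4, f 4) (x 3) (x 2) (x 1))"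
  unfolding pencil_symbol_def pencil_ratio_vec_def prod.case bracket_simps
  by (rule arg_cong[of _ _ bloch], simp add: divide_simps)+

text \<open>The last three coordinates are cross-ratios of four points of a line that does not contain
  \<open>x 1\<close>, projected from \<open>x 1\<close>; the point \<open>meet j 1\<close> lies on the line \<open>ker f\<^sub>1\<close> of
  the pencil, whence the argument \<open>meet 1 2\<close>. For the first one, the points \<open>x 1, meet 1 2, meet 1 3,
  meet 1 4\<close> of \<open>ker f\<^sub>1\<close> are projected to \<open>ker f\<^sub>2\<close> from \<open>meet 3 4\<close>, and then from \<open>x 1\<close>.\<close>

lemma symbol_dual_edges:
  "symbol (meet 1 2) (meet 3 4) (meet 2 4) (meet 2 3) =
    bloch (pencil_ratio_vec (f 1, x 1) (f 2) (f 3) (f 4))"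
  "symbol (meet 1 2) (x 2) (meet 2 3) (meet 2 4) =
    bloch (pencil_ratio_vec (f 2, x 2) (f 1) (f 4) (f 3))"
  "symbol (meet 1 2) (meet 2 3) (x 3) (meet 3 4) =
    bloch (pencil_ratio_vec (f 3, x 3) (f 4) (f 1) (f 2))"
  "symbol (meet 1 2) (meet 2 4) (meet 3 4) (x 4) =
    bloch (pencil_ratio_vec (f 4, x 4) (f 3) (f 2) (f 1))"
  unfolding pencil_symbol_def pencil_ratio_vec_def prod.case bracket_simps
  by (rule arg_cong[of _ _ bloch], simp add: divide_simps)+

definition face where "face i j k =
  (val i j * val j k * val k i) / (val i k * val j i * val k j)"

text \<open>In general \<open>- z\<^sub>i\<^sub>j\<^sub>k\<close> is the cross-ratio in the pencil through \<open>x i\<close> of \<open>ker f\<^sub>i\<close> and the lines to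
  \<open>meet j k\<close>, \<open>x j\<close>, \<open>x k\<close>. For the face without the vertex \<open>x 1\<close> the dual description is used:
  four points of \<open>ker f\<^sub>2\<close>, namely \<open>x 2\<close> and the intersections with \<open>x\<^sub>3x\<^sub>4\<close>, \<open>ker f\<^sub>3\<close>, \<open>ker f\<^sub>4\<close>.\<close>

lemma symbol_faces:
  "symbol (meet 1 2) (meet 2 3) (x 2) (x 3) = bloch (- face 1 2 3)"
  "symbol (x 2) crossing (meet 2 3) (meet 2 4) = bloch (- face 2 4 3)"
  "symbol (meet 1 2) (meet 3 4) (x 3) (x 4) = bloch (- face 1 3 4)"
  "symbol (meet 1 2) (meet 2 4) (x 4) (x 2) = bloch (- face 1 4 2)"
  unfolding pencil_symbol_def face_def bracket_simps
  by (rule arg_cong[of _ _ bloch], simp add: divide_simps)+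

text \<open>In the first equation, the perspectivity with centre \<open>x 4\<close> from the line \<open>ker f\<^sub>2\<close> to \<open>ker f\<^sub>3\<close> takes
  \<open>crossing\<close> to \<open>x 3\<close> and \<open>meet 2 4\<close> to \<open>meet 3 4\<close>, and it fixes \<open>meet 2 3\<close> and the line
  joining its centre to \<open>x 1\<close>; a double transposition then reorders the four points. The bracket of
  \<open>x 4\<close> and \<open>meet 2 3\<close> is a factor of both denominators, so the equation holds even if it
  vanishes. The second equation comes from the perspectivity with centre \<open>meet 2 3\<close> from the line
  \<open>x\<^sub>3x\<^sub>4\<close> to \<open>ker f\<^sub>4\<close>, which takes \<open>x 3\<close> to \<open>meet 3 4\<close> and \<open>crossing\<close> to \<open>meet 2 4\<close>.\<close>

lemma symbol_perspective:
  "symbol (x 4) crossing (meet 2 4) (meet 2 3) = symbol (x 3) (x 4) (meet 2 3) (meet 3 4)"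
  "symbol (x 3) crossing (meet 2 3) (x 4) = symbol (x 4) (meet 2 3) (meet 2 4) (meet 3 4)"
  unfolding pencil_symbol_def bracket_simps
  by (rule arg_cong[of _ _ bloch], simp add: divide_simps)+

lemma duality_identity:
  "bloch (pencil_ratio_vec (x 1, f 1) (x 2) (x 3) (x 4))
    + bloch (pencil_ratio_vec (x 2, f 2) (x 1) (x 4) (x 3))
    + bloch (pencil_ratio_vec (x 3, f 3) (x 4) (x 1) (x 2))
    + bloch (pencil_ratio_vec (x 4, f 4) (x 3) (x 2) (x 1)) =
    bloch (pencil_ratio_vec (f 1, x 1) (f 2) (f 3) (f 4))
    + bloch (pencil_ratio_vec (f 2, x 2) (f 1) (f 4) (f 3))
    + bloch (pencil_ratio_vec (f 3, x 3) (f 4) (f 1) (f 2))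
    + bloch (pencil_ratio_vec (f 4, x 4) (f 3) (f 2) (f 1))
    + bloch (- face 1 2 3) + bloch (- face 2 4 3) + bloch (- face 1 3 4) + bloch (- face 1 4 2)"
proof -
  let ?l = "meet 1 2"
  have flag_bracket: "det3 (x 1) ?l (x 2) \<noteq> 0" "det3 (x 1) ?l (x 3) \<noteq> 0" "det3 (x 1) ?l (x 4) \<noteq> 0"
    "det3 (x 1) ?l (meet 2 3) \<noteq> 0" "det3 (x 1) ?l (meet 2 4) \<noteq> 0" "det3 (x 1) ?l (meet 3 4) \<noteq> 0"
    by (simp_all add: bracket_flag_line pairing_meet)
  have vertex_bracket: "det3 (x 1) (x 2) (x 3) \<noteq> 0" "det3 (x 1) (x 2) (x 4) \<noteq> 0"
    "det3 (x 1) (x 2) (meet 2 3) \<noteq> 0" "det3 (x 1) (x 2) (meet 2 4) \<noteq> 0" "det3 (x 1) (x 2) crossing \<noteq> 0"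
    by (simp_all add: bracket_crossing bracket_meet)
  have perspective:
    "symbol (x 3) (x 4) (meet 2 3) (meet 3 4) = - symbol (x 4) (meet 2 3) (meet 2 4) crossing"
    "symbol (x 4) (meet 2 3) (meet 2 4) (meet 3 4) = - symbol (x 3) (x 4) (meet 2 3) crossing"
    using symbol_perspective pencil_symbol_swap_24[of "x 1" "x 4" crossing "meet 2 4" "meet 2 3"]
      pencil_symbol_swap_24[of "x 1" "x 3" crossing "meet 2 3" "x 4"] by simp_all
  \<comment> \<open>the signs with which the six relations add up to the identity\<close>
  have combine: "a + b - c - d - e + g = 0"
    if "a = 0" "b = 0" "c = 0" "d = 0" "e = 0" "g = 0" for a b c d e g :: bloch_group
    using that by simp
  note relation = combine[OF
    pencil_five_term[of "x 1" ?l "x 2" "x 3" "x 4" "meet 2 3"]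
    pencil_five_term[of "x 1" ?l "x 3" "x 4" "meet 2 3" "meet 3 4"]
    pencil_five_term[of "x 1" ?l "x 4" "meet 2 3" "meet 2 4" "meet 3 4"]
    pencil_five_term[of "x 1" ?l "x 2" "x 4" "meet 2 3" "meet 2 4"]
    pencil_five_term[of "x 1" "x 2" "x 3" "x 4" "meet 2 3" crossing]
    pencil_five_term[of "x 1" "x 2" "x 4" "meet 2 3" "meet 2 4" crossing],
    OF flag_bracket(1-4) flag_bracket(2,3,4,6) flag_bracket(3-6) flag_bracket(1,3,4,5)
      vertex_bracket(1,2,3,5) vertex_bracket(2-5)]
  have reorder:
    "symbol (x 2) crossing (x 3) (x 4) = symbol (x 2) (x 3) (x 4) crossing"
    "symbol (x 2) (x 3) crossing (meet 2 3) = - symbol (x 2) (x 3) (meet 2 3) crossing"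
    "symbol ?l (meet 3 4) (meet 2 4) (meet 2 3) = - symbol ?l (meet 2 3) (meet 2 4) (meet 3 4)"
    "symbol ?l (meet 2 3) (x 3) (meet 3 4) = - symbol ?l (x 3) (meet 2 3) (meet 3 4)"
    "symbol ?l (meet 2 4) (meet 3 4) (x 4) = symbol ?l (x 4) (meet 2 4) (meet 3 4)"
    "symbol ?l (meet 2 3) (x 2) (x 3) = symbol ?l (x 2) (x 3) (meet 2 3)"
    "symbol (x 2) crossing (meet 2 3) (meet 2 4) = symbol (x 2) (meet 2 3) (meet 2 4) crossing"
    "symbol ?l (meet 3 4) (x 3) (x 4) = symbol ?l (x 3) (x 4) (meet 3 4)"
    "symbol ?l (meet 2 4) (x 4) (x 2) = - symbol ?l (x 2) (x 4) (meet 2 4)"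
    by (rule pencil_symbol_swap_23 pencil_symbol_swap_24 pencil_symbol_swap_34 pencil_symbol_cycle)+
  show ?thesis
    using relation
    unfolding symbol_edges[symmetric] symbol_dual_edges[symmetric] symbol_faces[symmetric]
      reorder perspective
    by (simp add: algebra_simps)
qed

text \<open>The difference of numerator and denominator of \<open>z\<^sub>i\<^sub>j\<close> is \<open>f\<^sub>i(x\<^sub>j) det(x\<^sub>i, x\<^sub>k, x\<^sub>l)\<close>.\<close>

lemma edge_not_0_1:
  assumes "distinct [i, j, k, l]"
  shows "pencil_ratio_vec (x i, f i) (x j) (x k) (x l) \<notin> {0, 1}"
proof -
  have "point_det i k l * val i j = val i k * point_det i j l - val i l * point_det i j k"
    using det3_linear_relation[of "x j" "x k" "x l" "f i" "x i"] by (simp add: algebra_simps)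
  then have "val i k * point_det i j l - val i l * point_det i j k \<noteq> 0"
    using assms by (metis distinct_length_2_or_more mult_eq_0_iff not_collinear off_line)
  then show ?thesis
    using assms by (auto simp: pencil_ratio_vec_def)
qed

text \<open>The sum of numerator and denominator of \<open>z\<^sub>i\<^sub>j\<^sub>k\<close> is the determinant of the pairings, hence the
  product of \<open>det(x\<^sub>i, x\<^sub>j, x\<^sub>k)\<close> and \<open>det(f\<^sub>i, f\<^sub>j, f\<^sub>k)\<close>: this is where the lines must not be
  concurrent.\<close>

lemma face_not_0_1:
  assumes "distinct [i, j, k]"
  shows "- face i j k \<notin> {0, 1}"
proof -
  have "point_det i j k * line_det i j k = val i j * val j k * val k i + val i k * val j i * val k j"
    using det3_mult[of "x i" "x j" "x k" "f i" "f j" "f k"] by (simp add: mult_ac)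
  then have "val i j * val j k * val k i + val i k * val j i * val k j \<noteq> 0"
    using assms by (metis mult_eq_0_iff not_collinear not_concurrent)
  then show ?thesis
    using assms by (auto simp: face_def field_simps add_eq_0_iff)
qed

lemma dual: "very_generic_vectors f x"
  by unfold_locales (simp_all add: pairing_commute[of "x i" "f j" for i j] del: distinct.simps)

end

section \<open>Configurations of flags\<close>

lemma common_zero_if_det3_eq_0:
  assumes "det3 x y z = 0"
  shows "\<exists>g. g \<noteq> 0 \<and> pairing g x = 0 \<and> pairing g y = 0 \<and> pairing g z = 0"
proof -
  have "\<not> invertible (vector [x, y, z] :: complex^3^3)"
    using assms by (simp add: det3_def invertible_det_nz)
  then obtain g where g: "(vector [x, y, z] :: complex^3^3) *v g = 0" "g \<noteq> 0"
    by (auto simp: invertible_left_inverse matrix_left_invertible_ker)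
  then have "pairing g x = 0 \<and> pairing g y = 0 \<and> pairing g z = 0"
    by (auto simp: vec_eq_iff forall_3 matrix_vector_mult_def sum_3 pairing_3 mult.commute)
  with g(2) show ?thesis by blast
qed

lemma very_generic_vectors_exist:
  fixes T :: "4 config"
  assumes "very_generic T"
  obtains x f where "very_generic_vectors x f" "\<And>i. flag_rel (x i, f i) (x i, f i)"
    "T = abs_config (\<lambda>i. abs_flag (x i, f i))"
proof -
  obtain F where T: "T = abs_config F"
    by (metis Quotient_abs_rep Quotient_config)
  have "\<exists>v. flag_rel v v \<and> G = abs_flag v" for G
    by (induct G rule: flag.abs_induct) blast
  then have "\<forall>i. \<exists>v. flag_rel v v \<and> F i = abs_flag v"
    by blast
  from choice[OF this] obtain v where v: "flag_rel (v i) (v i)" "F i = abs_flag (v i)" for i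
    by blast
  define x f where "x = fst \<circ> v" and "f = snd \<circ> v"
  have rel: "flag_rel (x i, f i) (x i, f i)" and F: "F i = abs_flag (x i, f i)" for i
    using v by (simp_all add: x_def f_def)
  have "very_generic_vectors x f"
  proof
    fix i j k :: 4
    show "pairing (f i) (x i) = 0"
      using rel[of i] by (simp add: flag_rel_refl)
    show "pairing (f i) (x j) \<noteq> 0" if "i \<noteq> j"
      using assms that
      by (simp add: very_generic_def T F generic.abs_eq incident.abs_eq rel)
    show "det3 (x i) (x j) (x k) \<noteq> 0" if ijk: "distinct [i, j, k]"
    proof -
      have "\<not> collinear_points (F i) (F j) (F k)"
        using assms ijk by (simp add: very_generic_def T generic.abs_eq)
      then show ?thesis
        using common_zero_if_det3_eq_0[of "x i" "x j" "x k"]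
        by (auto simp: F collinear_points.abs_eq rel)
    qed
    show "det3 (f i) (f j) (f k) \<noteq> 0" if ijk: "distinct [i, j, k]"
    proof -
      have "\<not> concurrent_lines (F i) (F j) (F k)"
        using assms ijk by (simp add: very_generic_def T no_three_lines_concurrent.abs_eq)
      then show ?thesis
        using common_zero_if_det3_eq_0[of "f i" "f j" "f k"]
        by (auto simp: F concurrent_lines.abs_eq rel pairing_commute[of "f _"])
    qed
  qed
  moreover have "T = abs_config (\<lambda>i. abs_flag (x i, f i))"
    unfolding T by (intro arg_cong[of _ _ abs_config] ext F)
  ultimately show thesis
    using rel that by blast
qed

theorem proposition3p6:
  fixes T :: "4 config"
  assumes "very_generic T"
  shows "Bloch_invariant T =
    Bloch_invariant (dual_config T)
      \<otimes>\<^bsub>pre_Bloch\<^esub> Bloch_class (- face_coord T 1 2 3)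
      \<otimes>\<^bsub>pre_Bloch\<^esub> Bloch_class (- face_coord T 2 4 3)
      \<otimes>\<^bsub>pre_Bloch\<^esub> Bloch_class (- face_coord T 1 3 4)
      \<otimes>\<^bsub>pre_Bloch\<^esub> Bloch_class (- face_coord T 1 4 2)"
proof -
  obtain x f where vectors: "very_generic_vectors x f" and rel: "\<And>i. flag_rel (x i, f i) (x i, f i)"
    and T: "T = abs_config (\<lambda>i. abs_flag (x i, f i))"
    using assms by (rule very_generic_vectors_exist) blast
  interpret very_generic_vectors x f by (fact vectors)
  interpret dual: very_generic_vectors f x by (fact dual)
  have rel': "flag_rel (f i, x i) (f i, x i)" for i
    using rel[of i] by (simp add: flag_rel_refl pairing_commute)
  have T': "dual_config T = abs_config (\<lambda>i. abs_flag (f i, x i))"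
    by (simp add: T dual_config.abs_eq dual_flag.abs_eq rel)
  have edges: "edge_coord T i j = pencil_ratio_vec (x i, f i) (x j) (x k) (x l)"
    "edge_coord (dual_config T) i j = pencil_ratio_vec (f i, x i) (f j) (f k) (f l)"
    if "even_completion i j = (k, l)" for i j k l
    using that by (simp add: T edge_coord.abs_eq pencil_ratio.abs_eq rel)
      (use that in \<open>simp add: T' edge_coord.abs_eq pencil_ratio.abs_eq rel'\<close>)
  have faces: "face_coord T i j k = face i j k" for i j k
    unfolding T by (simp add: face_coord.abs_eq triple_ratio.abs_eq rel face_def)
  have sum: "Rep_bloch_group (a + b) = Rep_bloch_group a \<otimes>\<^bsub>pre_Bloch\<^esub> Rep_bloch_group b" for a b
    by (fact plus_bloch_group.rep_eq)
  note classes = edge_not_0_1[THEN Rep_bloch] dual.edge_not_0_1[THEN Rep_bloch] face_not_0_1[THEN Rep_bloch]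
  have eq: "Rep_bloch_group
      (bloch (pencil_ratio_vec (x 1, f 1) (x 2) (x 3) (x 4))
      + bloch (pencil_ratio_vec (x 2, f 2) (x 1) (x 4) (x 3))
      + bloch (pencil_ratio_vec (x 3, f 3) (x 4) (x 1) (x 2))
      + bloch (pencil_ratio_vec (x 4, f 4) (x 3) (x 2) (x 1))) = Rep_bloch_group
      (bloch (pencil_ratio_vec (f 1, x 1) (f 2) (f 3) (f 4))
      + bloch (pencil_ratio_vec (f 2, x 2) (f 1) (f 4) (f 3))
      + bloch (pencil_ratio_vec (f 3, x 3) (f 4) (f 1) (f 2))
      + bloch (pencil_ratio_vec (f 4, x 4) (f 3) (f 2) (f 1))
      + bloch (- face 1 2 3) + bloch (- face 2 4 3) + bloch (- face 1 3 4) + bloch (- face 1 4 2))"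
    by (simp only: duality_identity)
  show ?thesis
    using eq unfolding Bloch_invariant_def faces by (simp add: sum classes edges even_completion_values)
qed

end
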